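(* Let $h\geq 2$ be an integer, let $m_0=2h(2h-1)$, $m_1=(2h+1)(2h-1)$, $m_2=2h(2h+1)$, $m_3=2h(2h+1)+(2h-1)$, and let $\Gamma_h=\langle m_0,m_1,m_2,m_3\rangle$ be the numerical semigroup generated by these integers. Then the Apéry set of $\Gamma_h$ with respect to $m_0$ is $$\mathrm{Ap}(\Gamma_h,m_0)=\{0\}\cup A_1\cup A_2\cup A_3\cup A_4\cup A_5,$$ where $A_1=\{im_1\mid 1\leq i\leq 2h-1\}$, $A_2=\{im_2\mid 1\leq i\leq 2h-2\}$, $A_3=\{im_3\mid 1\leq i\leq 2h-2\}$, $A_4=\{im_1+jm_3\mid 1\leq i\leq 2h-2,\ 1\leq j\leq (2h-1)-i\}$, $A_5=\{im_2+jm_3\mid 1\leq i\leq 2h-3,\ 1\leq j\leq (2h-2)-i\}$.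
   Context: For integers $a_1,\dots,a_e\ge 1$ with gcd $1$, $\langle a_1,\dots,a_e\rangle=\{\sum s_ia_i\mid s_i\in\mathbb{Z}_{\geq 0}\}$. For a numerical semigroup $\Gamma$ and $0\neq a\in\Gamma$, the Apéry set is $\mathrm{Ap}(\Gamma,a)=\{s\in\Gamma\mid s-a\notin\Gamma\}$. *)

theory Defs
  imports Main
begin

text \<open>Semigroups and their generators live in \<^typ>\<open>int\<close>, so that the difference \<open>s - a\<close> in the
  definition of the Apery set is the true difference and not truncated subtraction.\<close>

definition semigroup_gen :: "int list \<Rightarrow> int set" where
  "semigroup_gen as = {(\<Sum>i<length as. int (s i) * as ! i) | s. True}"

definition Apery :: "int set \<Rightarrow> int \<Rightarrow> int set" where
  "Apery \<Gamma> a = {s \<in> \<Gamma>. s - a \<notin> \<Gamma>}"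

text \<open>The generators below are positive and have greatest common divisor 1, so that the semigroup
  they generate is indeed a numerical semigroup.\<close>

lemma generators_pos:
  fixes h :: int
  assumes "h \<ge> 2"
  shows "2*h*(2*h-1) > 0" "(2*h+1)*(2*h-1) > 0" "2*h*(2*h+1) > 0" "2*h*(2*h+1) + (2*h-1) > 0"
proof -
  show "2*h*(2*h-1) > 0" "(2*h+1)*(2*h-1) > 0" "2*h*(2*h+1) > 0"
    using assms by simp_all
  then show "2*h*(2*h+1) + (2*h-1) > 0"
    using assms by linarith
qed

lemma generators_Gcd:
  fixes h :: int
  shows "Gcd {2*h*(2*h-1), (2*h+1)*(2*h-1), 2*h*(2*h+1), 2*h*(2*h+1) + (2*h-1)} = 1"
proof -
  let ?g = "Gcd {2*h*(2*h-1), (2*h+1)*(2*h-1), 2*h*(2*h+1), 2*h*(2*h+1) + (2*h-1)}"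
  have g: "?g dvd 2*h*(2*h-1)" "?g dvd (2*h+1)*(2*h-1)" "?g dvd 2*h*(2*h+1)"
    by (rule Gcd_dvd; simp)+
  let ?d = "(2*h+1)*(2*h-1) - 2*h*(2*h-1)"
  have d: "?g dvd ?d"
    using g(2,1) by (rule dvd_diff)
  have "?g dvd ?d - (h-1) * (2*h*(2*h+1) - (2*h+2) * ?d)"
    by (rule dvd_diff[OF d dvd_mult[OF dvd_diff[OF g(3) dvd_mult[OF d]]]])
  also have "?d - (h-1) * (2*h*(2*h+1) - (2*h+2) * ?d) = 1"
    by (simp add: algebra_simps)
  finally have "?g dvd 1" .
  then show ?thesis
    using Gcd_int_greater_eq_0 zdvd1_eq by (metis abs_of_nonneg)
qed

end

theory Submission
  imports Defs
begin

text \<open>Put \<open>n = 2h\<close>. Since \<open>m1 + m2 = m0 + m3\<close>, every element of the semigroup is congruent modulo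
  \<open>m0 = n (n - 1)\<close> to \<open>p m1 + q m2\<close> for some \<open>p, q \<ge> 0\<close>, and the least element that this relation
  alone produces from \<open>(p, q)\<close> is \<open>p m1 + q m2 - min p q m0\<close>. As \<open>m1 \<equiv> -1\<close>, \<open>m2 \<equiv> 0\<close> modulo \<open>n\<close>
  and \<open>m1 \<equiv> 0\<close>, \<open>m2 \<equiv> 2\<close> modulo the odd number \<open>n - 1\<close>, the residue class modulo \<open>m0\<close> determines
  \<open>p\<close> modulo \<open>n\<close> and \<open>q\<close> modulo \<open>n - 1\<close>. Reducing \<open>p\<close> and \<open>q\<close> does not increase the value, so the
  Apery set consists of the values at \<open>0 \<le> p < n\<close>, \<open>0 \<le> q < n - 1\<close>.\<close>

definition reduced_elt :: "int \<Rightarrow> int \<Rightarrow> int \<Rightarrow> int" where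
  "reduced_elt n p q = p * (n\<^sup>2 - 1) + q * (n\<^sup>2 + n) - min p q * (n * (n - 1))"

text \<open>Each of the \<open>q\<close> pairs \<open>m1 + m2\<close>, lowered by \<open>m0\<close>,
  becomes one \<open>m3\<close>, and \<open>p - q\<close> copies of \<open>m1\<close> stay unpaired.
  This is the shape of the elements of \<open>A4\<close>; the case \<open>p \<le> q\<close> gives
  that of \<open>A5\<close>.\<close>

lemma reduced_elt_ge:
  "q \<le> p \<Longrightarrow> reduced_elt n p q = (p - q) * (n\<^sup>2 - 1) + q * (n\<^sup>2 + 2 * n - 1)"
  by (simp add: reduced_elt_def min_def algebra_simps power2_eq_square)

lemma reduced_elt_le:
  "p \<le> q \<Longrightarrow> reduced_elt n p q = (q - p) * (n\<^sup>2 + n) + p * (n\<^sup>2 + 2 * n - 1)"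
  by (simp add: reduced_elt_def min_def algebra_simps power2_eq_square)

lemma semigroup_gen_4:
  "semigroup_gen [a, b, c, d] =
    {k * a + x * b + y * c + z * d | k x y z. k \<ge> 0 \<and> x \<ge> 0 \<and> y \<ge> 0 \<and> z \<ge> 0}"
  (is "?L = ?R")
proof
  show "?L \<subseteq> ?R"
  proof
    fix t assume "t \<in> ?L"
    then obtain s :: "nat \<Rightarrow> nat" where "t = (\<Sum>i<length [a, b, c, d]. int (s i) * [a, b, c, d] ! i)"
      by (auto simp: semigroup_gen_def)
    then have "t = int (s 0) * a + int (s 1) * b + int (s 2) * c + int (s 3) * d"
      by (simp add: eval_nat_numeral)
    then show "t \<in> ?R"
      using of_nat_0_le_iff by blast
  qed
next
  show "?R \<subseteq> ?L"
  proof
    fix t assume "t \<in> ?R"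
    then obtain k x y z where t: "t = k * a + x * b + y * c + z * d"
      and nonneg: "k \<ge> 0" "x \<ge> 0" "y \<ge> 0" "z \<ge> 0"
      by blast
    \<comment> \<open>Values of \<open>s\<close> beyond index 3 are unspecified, but the sum never
      reaches them.\<close>
    define s where "s i = nat ([k, x, y, z] ! i)" for i
    have "t = (\<Sum>i<length [a, b, c, d]. int (s i) * [a, b, c, d] ! i)"
      using nonneg by (simp add: s_def t eval_nat_numeral)
    then show "t \<in> ?L"
      unfolding semigroup_gen_def by blast
  qed
qed

lemma semigroup_gen_eq_reduced_elt:
  fixes n :: int
  shows "semigroup_gen [n * (n - 1), n\<^sup>2 - 1, n\<^sup>2 + n, n\<^sup>2 + 2 * n - 1] =
    {reduced_elt n p q + k * (n * (n - 1)) | p q k. p \<ge> 0 \<and> q \<ge> 0 \<and> k \<ge> 0}"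
  (is "?L = ?R")
proof
  show "?L \<subseteq> ?R"
  proof
    fix t assume "t \<in> ?L"
    then obtain k x y z where t: "t = k * (n * (n - 1)) + x * (n\<^sup>2 - 1) + y * (n\<^sup>2 + n) + z * (n\<^sup>2 + 2 * n - 1)"
      and nonneg: "k \<ge> 0" "x \<ge> 0" "y \<ge> 0" "z \<ge> 0"
      by (auto simp: semigroup_gen_4)
    \<comment> \<open>Each \<open>m3\<close> is counted as \<open>m1 + m2 - m0\<close>, hence
      \<open>z\<close> in both arguments. Pairing the remaining \<open>m1\<close> and
      \<open>m2\<close> frees \<open>min x y\<close> further copies of \<open>m0\<close>.\<close>
    have "t = reduced_elt n (x + z) (y + z) + (k + min x y) * (n * (n - 1))"
      by (simp add: t reduced_elt_def min_add_distrib_left[symmetric] algebra_simps power2_eq_square)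
    then show "t \<in> ?R"
      using nonneg by (intro CollectI exI[of _ "x + z"] exI[of _ "y + z"] exI[of _ "k + min x y"]) auto
  qed
next
  show "?R \<subseteq> ?L"
  proof
    fix t assume "t \<in> ?R"
    then obtain p q k where t: "t = reduced_elt n p q + k * (n * (n - 1))"
      and nonneg: "p \<ge> 0" "q \<ge> 0" "k \<ge> 0"
      by blast
    have "t = k * (n * (n - 1)) + (p - min p q) * (n\<^sup>2 - 1) + (q - min p q) * (n\<^sup>2 + n)
        + min p q * (n\<^sup>2 + 2 * n - 1)"
      by (simp add: t reduced_elt_def algebra_simps power2_eq_square)
    moreover have "p - min p q \<ge> 0" "q - min p q \<ge> 0" "min p q \<ge> 0"
      using nonneg by auto
    ultimately show "t \<in> ?L"
      using nonneg unfolding semigroup_gen_4 by blast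
  qed
qed

text \<open>Both reductions cost the same: \<open>n * m1\<close> and \<open>(n - 1) * m2\<close>
  each equal \<open>(n + 1) * m0\<close>.\<close>

lemma reduced_elt_mod:
  fixes n p q :: int
  assumes "n \<ge> 2" "p \<ge> 0" "q \<ge> 0"
  obtains k where "k \<ge> 0"
    "reduced_elt n p q = reduced_elt n (p mod n) (q mod (n - 1)) + k * (n * (n - 1))"
proof
  define r s u v where "r = p mod n" and "s = q mod (n - 1)" and "u = p div n" and "v = q div (n - 1)"
  have pq: "p = r + n * u" "q = s + (n - 1) * v"
    by (simp_all add: r_def s_def u_def v_def)
  have uv: "u \<ge> 0" "v \<ge> 0"
    using assms by (simp_all add: u_def v_def pos_imp_zdiv_nonneg_iff)
  define k where "k = (n + 1) * (u + v) - (min p q - min r s)"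
  \<comment> \<open>Passing to remainders also shrinks the correction by \<open>min\<close>, but by
    at most the total decrease of the two arguments, which \<open>(n + 1) * (u + v)\<close>
    dominates.\<close>
  have "n * u \<ge> 0" "(n - 1) * v \<ge> 0"
    using assms uv by simp_all
  then have "min p q - min r s \<le> n * u + (n - 1) * v"
    by (simp add: pq min_def)
  also have "\<dots> \<le> (n + 1) * (u + v)"
    using uv by (simp add: algebra_simps)
  finally show "k \<ge> 0"
    by (simp add: k_def)
  have "reduced_elt n p q = reduced_elt n r s + k * (n * (n - 1))"
    unfolding reduced_elt_def k_def by (simp add: pq algebra_simps power2_eq_square)
  then show "reduced_elt n p q = reduced_elt n (p mod n) (q mod (n - 1)) + k * (n * (n - 1))"
    by (simp add: r_def s_def)
qed

text \<open>The integer \<open>k\<close> may have any sign, so distinct points of the rectangle lie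
  in distinct residue classes modulo \<open>m0\<close>.\<close>

lemma reduced_elt_cong_imp_eq:
  fixes n :: int
  assumes "even n"
    and p: "0 \<le> p" "p < n" "0 \<le> p'" "p' < n"
    and q: "0 \<le> q" "q < n - 1" "0 \<le> q'" "q' < n - 1"
    and eq: "reduced_elt n p q = reduced_elt n p' q' + k * (n * (n - 1))"
  shows "p = p' \<and> q = q'"
proof
  define l where "l = k + (min p q - min p' q')"
  have eq': "(p - p') * (n\<^sup>2 - 1) + (q - q') * (n\<^sup>2 + n) = l * (n * (n - 1))"
    using eq by (simp add: reduced_elt_def l_def algebra_simps)
  have "p - p' = n * ((p - p') * n + (q - q') * (n + 1) - l * (n - 1))"
    using eq' by (simp add: algebra_simps power2_eq_square)
  then have "n dvd p - p'"
    by (rule dvdI)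
  then have "p mod n = p' mod n"
    by (simp add: mod_eq_dvd_iff)
  then show "p = p'"
    using p by simp
  \<comment> \<open>The cofactor comes from \<open>n\<^sup>2 + n = (n - 1) * (n + 2) + 2\<close>;
    the factor 2 is cancelled below because \<open>n - 1\<close> is odd.\<close>
  have "2 * (q - q') = (n - 1) * (l * n - (p - p') * (n + 1) - (q - q') * (n + 2))"
    using eq' by (simp add: algebra_simps power2_eq_square)
  then have "n - 1 dvd 2 * (q - q')"
    by (rule dvdI)
  moreover have "coprime (n - 1) 2"
    using \<open>even n\<close> by simp
  ultimately have "n - 1 dvd q - q'"
    by (metis coprime_dvd_mult_right_iff)
  then have "q mod (n - 1) = q' mod (n - 1)"
    by (simp add: mod_eq_dvd_iff)
  then show "q = q'"
    using q by simp
qed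

lemma Apery_eq_reduced_elt:
  fixes n :: int
  assumes "n \<ge> 2" "even n"
  shows "Apery (semigroup_gen [n * (n - 1), n\<^sup>2 - 1, n\<^sup>2 + n, n\<^sup>2 + 2 * n - 1]) (n * (n - 1)) =
    {reduced_elt n p q | p q. 0 \<le> p \<and> p < n \<and> 0 \<le> q \<and> q < n - 1}"
  (is "Apery ?\<Gamma> ?m = ?R")
proof
  note \<Gamma> = semigroup_gen_eq_reduced_elt[of n]
  show "Apery ?\<Gamma> ?m \<subseteq> ?R"
  proof
    fix s assume "s \<in> Apery ?\<Gamma> ?m"
    then have s: "s \<in> ?\<Gamma>" "s - ?m \<notin> ?\<Gamma>"
      by (auto simp: Apery_def)
    from s(1) obtain p q k where pqk: "s = reduced_elt n p q + k * ?m" "p \<ge> 0" "q \<ge> 0" "k \<ge> 0"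
      unfolding \<Gamma> by blast
    obtain l where l: "l \<ge> 0" "reduced_elt n p q = reduced_elt n (p mod n) (q mod (n - 1)) + l * ?m"
      using reduced_elt_mod assms(1) pqk(2,3) by metis
    have range: "0 \<le> p mod n" "p mod n < n" "0 \<le> q mod (n - 1)" "q mod (n - 1) < n - 1"
      using assms by simp_all
    \<comment> \<open>A spare copy of \<open>m0\<close> could be removed from \<open>s\<close>
      without leaving the semigroup.\<close>
    have "\<not> k + l \<ge> 1"
    proof
      assume "k + l \<ge> 1"
      moreover have "s - ?m = reduced_elt n (p mod n) (q mod (n - 1)) + (k + l - 1) * ?m"
        using pqk(1) l(2) by (simp add: algebra_simps)
      ultimately have "s - ?m \<in> ?\<Gamma>"
        unfolding \<Gamma> using range
        by (intro CollectI exI[of _ "p mod n"] exI[of _ "q mod (n - 1)"] exI[of _ "k + l - 1"]) auto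
      then show False
        using s(2) by blast
    qed
    then have "k = 0" "l = 0"
      using pqk(4) l(1) by linarith+
    then have "s = reduced_elt n (p mod n) (q mod (n - 1))"
      using pqk(1) l(2) by simp
    then show "s \<in> ?R"
      using range by blast
  qed
next
  note \<Gamma> = semigroup_gen_eq_reduced_elt[of n]
  show "?R \<subseteq> Apery ?\<Gamma> ?m"
  proof
    fix s assume "s \<in> ?R"
    then obtain p q where s: "s = reduced_elt n p q" and pq: "0 \<le> p" "p < n" "0 \<le> q" "q < n - 1"
      by blast
    have "s \<in> ?\<Gamma>"
      unfolding \<Gamma> using s pq by (intro CollectI exI[of _ p] exI[of _ q] exI[of _ 0]) auto
    moreover have "s - ?m \<notin> ?\<Gamma>"
    proof
      assume "s - ?m \<in> ?\<Gamma>"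
      then obtain p' q' k where k: "s - ?m = reduced_elt n p' q' + k * ?m" "p' \<ge> 0" "q' \<ge> 0" "k \<ge> 0"
        unfolding \<Gamma> by blast
      obtain l where l: "l \<ge> 0"
        "reduced_elt n p' q' = reduced_elt n (p' mod n) (q' mod (n - 1)) + l * ?m"
        using reduced_elt_mod assms(1) k(2,3) by metis
      \<comment> \<open>Uniqueness in the rectangle will force the multiple of \<open>m0\<close> to
        vanish, although \<open>k + l + 1\<close> is positive.\<close>
      have eq: "reduced_elt n p q = reduced_elt n (p' mod n) (q' mod (n - 1)) + (k + l + 1) * ?m"
        using k(1) l(2) s by (simp add: algebra_simps)
      have "p = p' mod n \<and> q = q' mod (n - 1)"
        using assms by (intro reduced_elt_cong_imp_eq[OF \<open>even n\<close> pq(1,2) _ _ pq(3,4) _ _ eq]) simp_all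
      then have "(k + l + 1) * ?m = 0"
        using eq by simp
      then show False
        using assms k(4) l(1) by auto
    qed
    ultimately show "s \<in> Apery ?\<Gamma> ?m"
      by (simp add: Apery_def)
  qed
qed

theorem theorem3p1:
  fixes h m0 m1 m2 m3 :: int and \<Gamma> :: "int set"
  assumes "h \<ge> 2"
    and "m0 = 2*h*(2*h-1)"
    and "m1 = (2*h+1)*(2*h-1)"
    and "m2 = 2*h*(2*h+1)"
    and "m3 = 2*h*(2*h+1) + (2*h-1)"
    and "\<Gamma> = semigroup_gen [m0, m1, m2, m3]"
  shows "Apery \<Gamma> m0 =
      {0}
      \<union> {i*m1 | i. 1 \<le> i \<and> i \<le> 2*h-1}
      \<union> {i*m2 | i. 1 \<le> i \<and> i \<le> 2*h-2}
      \<union> {i*m3 | i. 1 \<le> i \<and> i \<le> 2*h-2}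
      \<union> {i*m1 + j*m3 | i j. 1 \<le> i \<and> i \<le> 2*h-2 \<and> 1 \<le> j \<and> j \<le> (2*h-1) - i}
      \<union> {i*m2 + j*m3 | i j. 1 \<le> i \<and> i \<le> 2*h-3 \<and> 1 \<le> j \<and> j \<le> (2*h-2) - i}"
proof -
  define n where "n = 2 * h"
  have n: "n \<ge> 4" "even n"
    using \<open>h \<ge> 2\<close> by (simp_all add: n_def)
  have m: "m0 = n * (n - 1)" "m1 = n\<^sup>2 - 1" "m2 = n\<^sup>2 + n" "m3 = n\<^sup>2 + 2 * n - 1"
    using assms(2-5) by (simp_all add: n_def algebra_simps power2_eq_square)
  note ge = reduced_elt_ge[of _ _ n, folded m]
  note le = reduced_elt_le[of _ _ n, folded m]
  have Apery: "Apery \<Gamma> m0 = {reduced_elt n p q | p q. 0 \<le> p \<and> p < n \<and> 0 \<le> q \<and> q < n - 1}"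
    using Apery_eq_reduced_elt[of n] n unfolding assms(6) m by simp
  have reduced_eltI: "reduced_elt n p q \<in> Apery \<Gamma> m0"
    if "0 \<le> p" "p < n" "0 \<le> q" "q < n - 1" for p q
    using that unfolding Apery by blast
  let ?A1 = "{i*m1 | i. 1 \<le> i \<and> i \<le> n-1}"
  let ?A2 = "{i*m2 | i. 1 \<le> i \<and> i \<le> n-2}"
  let ?A3 = "{i*m3 | i. 1 \<le> i \<and> i \<le> n-2}"
  let ?A4 = "{i*m1 + j*m3 | i j. 1 \<le> i \<and> i \<le> n-2 \<and> 1 \<le> j \<and> j \<le> (n-1) - i}"
  let ?A5 = "{i*m2 + j*m3 | i j. 1 \<le> i \<and> i \<le> n-3 \<and> 1 \<le> j \<and> j \<le> (n-2) - i}"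
  show ?thesis
    unfolding n_def[symmetric]
  proof (intro equalityI subsetI)
    fix s assume "s \<in> Apery \<Gamma> m0"
    then obtain p q where s: "s = reduced_elt n p q" and pq: "0 \<le> p" "p < n" "0 \<le> q" "q < n - 1"
      unfolding Apery by blast
    \<comment> \<open>The rectangle splits into the origin, the two axes, the diagonal and the
      regions on either side of it, matching \<open>{0}\<close> and \<open>A1\<close> to
      \<open>A5\<close> in order.\<close>
    consider "p = 0" "q = 0" | "q = 0" "p > 0" | "p = 0" "q > 0" | "p = q" "p > 0"
      | "q > 0" "p > q" | "p > 0" "q > p"
      using pq by linarith
    then show "s \<in> {0} \<union> ?A1 \<union> ?A2 \<union> ?A3 \<union> ?A4 \<union> ?A5"
    proof cases
      case 1
      then show ?thesis using s ge[of q p] by simp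
    next
      case 2
      then have "s \<in> ?A1"
        using s pq ge[of q p] by (intro CollectI exI[of _ p]) simp
      then show ?thesis by blast
    next
      case 3
      then have "s \<in> ?A2"
        using s pq le[of p q] by (intro CollectI exI[of _ q]) simp
      then show ?thesis by blast
    next
      case 4
      then have "s \<in> ?A3"
        using s pq ge[of q p] by (intro CollectI exI[of _ q]) simp
      then show ?thesis by blast
    next
      case 5
      then have "s \<in> ?A4"
        \<comment> \<open>Here \<open>i + j = p \<le> n - 1\<close>, whereas in the next case
          \<open>i + j = q \<le> n - 2\<close>; hence the different bounds in \<open>A4\<close> and
          \<open>A5\<close>.\<close>
        using s pq ge[of q p] by (intro CollectI exI[of _ "p - q"] exI[of _ q]) simp
      then show ?thesis by blast
    next
      case 6
      then have "s \<in> ?A5"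
        using s pq le[of p q] by (intro CollectI exI[of _ "q - p"] exI[of _ p]) simp
      then show ?thesis by blast
    qed
  next
    have "0 \<in> Apery \<Gamma> m0"
      using reduced_eltI[of 0 0] ge[of 0 0] n by simp
    moreover have "i * m1 \<in> Apery \<Gamma> m0" if "1 \<le> i" "i \<le> n - 1" for i
      using reduced_eltI[of i 0] ge[of 0 i] n that by simp
    moreover have "i * m2 \<in> Apery \<Gamma> m0" if "1 \<le> i" "i \<le> n - 2" for i
      using reduced_eltI[of 0 i] le[of 0 i] n that by simp
    moreover have "i * m3 \<in> Apery \<Gamma> m0" if "1 \<le> i" "i \<le> n - 2" for i
      using reduced_eltI[of i i] ge[of i i] that by simp
    moreover have "i * m1 + j * m3 \<in> Apery \<Gamma> m0" if "1 \<le> i" "1 \<le> j" "j \<le> (n - 1) - i" for i j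
      using reduced_eltI[of "i + j" j] ge[of j "i + j"] that by simp
    moreover have "i * m2 + j * m3 \<in> Apery \<Gamma> m0" if "1 \<le> i" "1 \<le> j" "j \<le> (n - 2) - i" for i j
      using reduced_eltI[of j "i + j"] le[of j "i + j"] that by simp
    ultimately show "s \<in> Apery \<Gamma> m0"
      if "s \<in> {0} \<union> ?A1 \<union> ?A2 \<union> ?A3 \<union> ?A4 \<union> ?A5" for s
      using that by blast
  qed
qed

end
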